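(* For any noncrossing partition $\pi$, $$\mu^s(\pi)=\begin{cases}0&\text{if }\pi\ne\mathrm{Base}(\pi),\\(-1)^{|\pi|-1}&\text{if }\pi=\mathrm{Base}(\pi).\end{cases}$$
   Context: $\mathbb{K}$ is a field of characteristic zero. A noncrossing partition is a partition $\pi$ of a set $[n]=\{1,\ldots,n\}$, $n\ge1$, into nonempty blocks such that there are no distinct blocks $b\ne b'$ and $x,z\in b$, $y,t\in b'$ with $x<y<z<t$. $|\pi|$ is its number of blocks; $\mathcal{NCP}$ is the set of all noncrossing partitions. For a nonempty set $Y$ of blocks of $\pi$, $\pi_{\mid Y}$ is the noncrossing partition obtained by deleting the blocks not in $Y$ and renumbering the remaining elements increasingly. The nesting order on blocks is $b\le_\pi b'\iff b'\subseteq[\min b,\max b]$; $\mathrm{Base}(\pi)$ is the set of blocks of $\pi$ minimal for $\le_\pi$. $\mathbb{K}[\mathcal{NCP}]$ is the free commutative algebra generated by $\mathcal{NCP}$, with product $\cdot$. It has a coproduct $\delta$, an algebra morphism given on $\pi\in\mathcal{NCP}$ by $\delta(\pi)=\sum_{\sim\in\mathcal{E}_c[\pi]}\pi/\!\sim\,\otimes\,\pi\mid_\cdot\sim$, where, for an equivalence $\sim$ on the set of blocks of $\pi$, $\pi/\!\sim$ is the partition whose blocks are the unions of the blocks in each class, $\mathcal{E}_c[\pi]$ is the set of $\sim$ for which $\pi/\!\sim$ is noncrossing, and $\pi\mid_\cdot\sim=\prod_{C\text{ class of }\sim}\pi_{\mid C}$. Its counit is the character with $\epsilon_\delta(\pi)=1$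 if $|\pi|=1$ and $0$ otherwise. Characters (algebra morphisms $\mathbb{K}[\mathcal{NCP}]\to\mathbb{K}$) form a monoid under $\lambda\star\mu=(\lambda\otimes\mu)\circ\delta$, with unit $\epsilon_\delta$; a character is invertible for $\star$ if and only if it does not vanish on noncrossing partitions with one block. $\lambda^s$ is the character with $\lambda^s(\pi)=1$ if $\pi=\mathrm{Base}(\pi)$ and $0$ otherwise, for $\pi\in\mathcal{NCP}$. It is invertible for $\star$ and $\mu^s$ denotes its inverse. *)

theory Defs
  imports
    "HOL-Library.Disjoint_Sets"
    "HOL-Library.Multiset"
    "HOL-Library.Poly_Mapping"
    "HOL-Library.Product_Plus"
    "HOL-Algebra.Group"
begin

section \<open>Noncrossing partitions\<close>

definition noncrossing :: "nat set set \<Rightarrow> bool" where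
  "noncrossing P \<longleftrightarrow>
     \<not> (\<exists>b\<in>P. \<exists>b'\<in>P. b \<noteq> b' \<and>
          (\<exists>x y z t. x \<in> b \<and> z \<in> b \<and> y \<in> b' \<and> t \<in> b' \<and> x < y \<and> y < z \<and> z < t))"

definition NCP :: "nat set set set" where
  "NCP = {P. \<exists>n\<ge>1. partition_on {1..n} P \<and> noncrossing P}"

typedef ncp = NCP
  morphisms blocks Abs_ncp
proof
  have "partition_on {1..1} {{1::nat}}" "noncrossing {{1}}"
    by (auto simp: partition_on_def noncrossing_def)
  then show "{{1}} \<in> NCP"
    unfolding NCP_def by blast
qed

definition nest_le :: "nat set \<Rightarrow> nat set \<Rightarrow> bool" where
  "nest_le b b' \<longleftrightarrow> b' \<subseteq> {Min b..Max b}"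

definition Base :: "ncp \<Rightarrow> nat set set" where
  "Base \<pi> = {b \<in> blocks \<pi>. \<forall>b'\<in>blocks \<pi>. nest_le b' b \<longrightarrow> b' = b}"

text \<open>The increasing bijection from a finite set \<open>S\<close> of naturals onto \<open>{1..card S}\<close>
  maps \<open>x\<close> to the number of elements of \<open>S\<close> that are at most \<open>x\<close>.\<close>

definition rank_in :: "nat set \<Rightarrow> nat \<Rightarrow> nat" where
  "rank_in S x = card {y \<in> S. y \<le> x}"

definition standardize :: "nat set set \<Rightarrow> nat set set" where
  "standardize Y = (\<lambda>b. rank_in (\<Union>Y) ` b) ` Y"

text \<open>The restriction of \<open>\<pi>\<close> to the set \<open>Y\<close> of blocks depends on \<open>Y\<close> only; it is meaningful
  for nonempty \<open>Y \<subseteq> blocks \<pi>\<close>, see \<open>blocks_restr\<close> below.\<close>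

definition restr :: "nat set set \<Rightarrow> ncp" where
  "restr Y = Abs_ncp (standardize Y)"

definition merge_blocks :: "ncp \<Rightarrow> (nat set \<times> nat set) set \<Rightarrow> nat set set" where
  "merge_blocks \<pi> r = Union ` (blocks \<pi> // r)"

definition Ec :: "ncp \<Rightarrow> (nat set \<times> nat set) set set" where
  "Ec \<pi> = {r. equiv (blocks \<pi>) r \<and> noncrossing (merge_blocks \<pi> r)}"

definition ncp_quot :: "ncp \<Rightarrow> (nat set \<times> nat set) set \<Rightarrow> ncp" where
  "ncp_quot \<pi> r = Abs_ncp (merge_blocks \<pi> r)"

text \<open>The arguments of \<open>Abs_ncp\<close> above are indeed noncrossing partitions.\<close>

lemma rank_in_mono:
  assumes "finite S" "x \<in> S" "y \<in> S" "x < y"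
  shows "rank_in S x < rank_in S y"
  unfolding rank_in_def
proof (rule psubset_card_mono)
  show "finite {z \<in> S. z \<le> y}" using assms by simp
  show "{z \<in> S. z \<le> x} \<subset> {z \<in> S. z \<le> y}" using assms by force
qed

lemma rank_in_less_iff:
  assumes "finite S" "x \<in> S" "y \<in> S"
  shows "rank_in S x < rank_in S y \<longleftrightarrow> x < y"
  using rank_in_mono[OF assms] rank_in_mono[OF assms(1,3,2)]
  by (metis linorder_less_linear order_less_asym)

lemma rank_in_bij:
  assumes "finite S"
  shows "bij_betw (rank_in S) S {1..card S}"
proof -
  have inj: "inj_on (rank_in S) S"
    by (rule inj_onI) (metis assms linorder_less_linear nat_neq_iff rank_in_mono)
  have "rank_in S ` S \<subseteq> {1..card S}"
  proof (intro image_subsetI)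
    fix x assume that: "x \<in> S"
    have "{y \<in> S. y \<le> x} \<noteq> {}" using that by blast
    then have "rank_in S x \<noteq> 0" using assms by (simp add: rank_in_def)
    moreover have "rank_in S x \<le> card S"
      unfolding rank_in_def using assms by (intro card_mono) auto
    ultimately show "rank_in S x \<in> {1..card S}" by simp
  qed
  then have "rank_in S ` S = {1..card S}"
    using inj by (simp add: card_image card_subset_eq)
  with inj show ?thesis by (simp add: bij_betw_def)
qed

lemma standardize_in_NCP:
  assumes Y: "Y \<subseteq> blocks \<pi>" "Y \<noteq> {}"
  shows "standardize Y \<in> NCP"
proof -
  obtain n where part: "partition_on {1..n} (blocks \<pi>)" and nc: "noncrossing (blocks \<pi>)"
    using blocks[of \<pi>] by (auto simp: NCP_def)
  define S where "S = \<Union>Y"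
  have ne: "{} \<notin> blocks \<pi>" and un: "\<Union>(blocks \<pi>) = {1..n}" and disj: "disjoint (blocks \<pi>)"
    using part by (simp_all add: partition_on_def)
  have "S \<subseteq> {1..n}"
    unfolding S_def un[symmetric] using Y(1) by (rule Union_mono)
  then have "finite S" by (rule finite_subset) simp
  moreover have "S \<noteq> {}"
    using Y ne unfolding S_def by (metis Union_upper all_not_in_conv subset_empty subset_iff)
  ultimately have S: "finite S" "S \<noteq> {}" by simp_all
  have sub: "b \<subseteq> S" if "b \<in> Y" for b using that by (auto simp: S_def)
  note bij = rank_in_bij[OF S(1)]
  have "partition_on S Y"
    using Y ne pairwise_subset[OF disj Y(1)] unfolding partition_on_def S_def by auto
  then have "partition_on (rank_in S ` S) ((`) (rank_in S) ` Y - {{}})"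
    by (rule partition_on_inj_image) (rule bij_betw_imp_inj_on[OF bij])
  moreover have "(`) (rank_in S) ` Y - {{}} = standardize Y"
    using Y ne unfolding standardize_def S_def by auto
  ultimately have "partition_on {1..card S} (standardize Y)"
    using bij by (simp add: bij_betw_def)
  moreover have "noncrossing (standardize Y)"
    unfolding noncrossing_def
  proof (intro notI, elim bexE conjE exE)
    fix c c' x y z t
    assume c: "c \<in> standardize Y" "c' \<in> standardize Y" "c \<noteq> c'"
      and m: "x \<in> c" "z \<in> c" "y \<in> c'" "t \<in> c'" and l: "x < y" "y < z" "z < t"
    obtain b b' where b: "b \<in> Y" "b' \<in> Y" "c = rank_in S ` b" "c' = rank_in S ` b'"
      using c by (auto simp: standardize_def S_def)
    obtain x0 y0 z0 t0 where m0: "x0 \<in> b" "z0 \<in> b" "y0 \<in> b'" "t0 \<in> b'"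
      and e: "x = rank_in S x0" "y = rank_in S y0" "z = rank_in S z0" "t = rank_in S t0"
      using m b by auto
    have lt: "x0 < y0" "y0 < z0" "z0 < t0"
      using l m0 b sub unfolding e by (auto simp: rank_in_less_iff S subset_iff)
    have "b \<noteq> b'" "b \<in> blocks \<pi>" "b' \<in> blocks \<pi>" using c b Y by auto
    with nc m0 lt show False
      unfolding noncrossing_def by metis
  qed
  moreover have "card S \<ge> 1" using S by (simp add: Suc_le_eq card_gt_0_iff)
  ultimately show ?thesis by (auto simp: NCP_def)
qed

lemma blocks_restr:
  "Y \<subseteq> blocks \<pi> \<Longrightarrow> Y \<noteq> {} \<Longrightarrow> blocks (restr Y) = standardize Y"
  by (simp add: restr_def Abs_ncp_inverse standardize_in_NCP)

lemma blocks_ncp_quot: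
  assumes "r \<in> Ec \<pi>"
  shows "blocks (ncp_quot \<pi> r) = merge_blocks \<pi> r"
proof -
  obtain n where n: "n \<ge> 1" and part: "partition_on {1..n} (blocks \<pi>)"
    using blocks[of \<pi>] by (auto simp: NCP_def)
  have eq: "equiv (blocks \<pi>) r" using assms by (simp add: Ec_def)
  have disj: "disjoint (blocks \<pi>)" and ne: "{} \<notin> blocks \<pi>"
    and un: "\<Union>(blocks \<pi>) = {1..n}"
    using part by (auto simp: partition_on_def)
  have sub: "C \<subseteq> blocks \<pi>" if "C \<in> blocks \<pi> // r" for C
    using that Union_quotient[OF eq] by blast
  have "partition_on {1..n} (merge_blocks \<pi> r)"
  proof (rule partition_onI)
    show "\<Union>(merge_blocks \<pi> r) = {1..n}"
      unfolding merge_blocks_def un[symmetric] by (subst (2) Union_quotient[OF eq, symmetric]) auto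
  next
    fix p q assume pq: "p \<in> merge_blocks \<pi> r" "q \<in> merge_blocks \<pi> r" "p \<noteq> q"
    then obtain C D where CD: "C \<in> blocks \<pi> // r" "D \<in> blocks \<pi> // r" "p = \<Union>C" "q = \<Union>D"
      by (auto simp: merge_blocks_def)
    then have "C \<inter> D = {}" using pq quotient_disj[OF eq] by blast
    then have "b \<inter> b' = {}" if "b \<in> C" "b' \<in> D" for b b'
      using that CD sub disj by (metis disjointD disjoint_iff subset_iff)
    then show "disjnt p q" using CD by (auto simp: disjnt_def)
  next
    show "{} \<notin> merge_blocks \<pi> r"
    proof
      assume "{} \<in> merge_blocks \<pi> r"
      then obtain C where C: "C \<in> blocks \<pi> // r" "\<Union>C = {}"
        by (auto simp: merge_blocks_def)
      have "C \<noteq> {}" by (rule in_quotient_imp_non_empty[OF eq C(1)])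
      then obtain b where "b \<in> C" by blast
      moreover from this have "b = {}" using C(2) by auto
      ultimately show False using sub[OF C(1)] ne by auto
    qed
  qed
  then have "merge_blocks \<pi> r \<in> NCP"
    using n assms by (auto simp: NCP_def Ec_def)
  then show ?thesis by (simp add: ncp_quot_def Abs_ncp_inverse)
qed

section \<open>The algebra and its coproduct\<close>

text \<open>The free commutative algebra on \<open>ncp\<close> is the monoid algebra of the free commutative
  monoid \<open>ncp multiset\<close>. For a monoid \<open>M\<close>, the algebra \<open>K[M] \<otimes> K[M]\<close> is the monoid algebra
  of \<open>M \<times> M\<close>, the basis element \<open>(a, b)\<close> standing for \<open>a \<otimes> b\<close>.\<close>

type_synonym 'k ncp_alg = "ncp multiset \<Rightarrow>\<^sub>0 'k"
type_synonym 'k ncp_alg2 = "(ncp multiset \<times> ncp multiset) \<Rightarrow>\<^sub>0 'k"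

definition gen :: "ncp \<Rightarrow> 'k::field_char_0 ncp_alg" where
  "gen \<pi> = Poly_Mapping.single {#\<pi>#} 1"

definition tens :: "'k::field_char_0 ncp_alg \<Rightarrow> 'k ncp_alg \<Rightarrow> 'k ncp_alg2" where
  "tens p q = (\<Sum>a\<in>Poly_Mapping.keys p. \<Sum>b\<in>Poly_Mapping.keys q.
     Poly_Mapping.single (a, b) (Poly_Mapping.lookup p a * Poly_Mapping.lookup q b))"

text \<open>The algebra morphism to a commutative \<open>K\<close>-algebra with structure map \<open>\<iota>\<close> that takes the
  values \<open>f\<close> on the generators. The constant \<open>c\<close> of a monoid algebra is \<open>Poly_Mapping.single 0 c\<close>.\<close>

definition alg_ext ::
  "('k::field_char_0 \<Rightarrow> 'a::comm_ring_1) \<Rightarrow> (ncp \<Rightarrow> 'a) \<Rightarrow> 'k ncp_alg \<Rightarrow> 'a" where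
  "alg_ext \<iota> f p =
     (\<Sum>m\<in>Poly_Mapping.keys p. \<iota> (Poly_Mapping.lookup p m) * (\<Prod>\<pi>\<in>#m. f \<pi>))"

lemma alg_ext_gen: "\<iota> 1 = 1 \<Longrightarrow> alg_ext \<iota> f (gen \<pi>) = f \<pi>"
  by (simp add: alg_ext_def gen_def)

definition delta :: "'k::field_char_0 ncp_alg \<Rightarrow> 'k ncp_alg2" where
  "delta = alg_ext (Poly_Mapping.single 0)
     (\<lambda>\<pi>. \<Sum>r\<in>Ec \<pi>. tens (gen (ncp_quot \<pi> r)) (\<Prod>C\<in>blocks \<pi> // r. gen (restr C)))"

section \<open>Characters\<close>

definition characters :: "('k::field_char_0 ncp_alg \<Rightarrow> 'k) set" where
  "characters = {\<phi>. (\<forall>p q. \<phi> (p + q) = \<phi> p + \<phi> q) \<and> (\<forall>p q. \<phi> (p * q) = \<phi> p * \<phi> q) \<and>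
     \<phi> 1 = 1 \<and> (\<forall>a p. \<phi> (Poly_Mapping.single 0 a * p) = a * \<phi> p)}"

text \<open>The linear form \<open>a \<otimes> b \<mapsto> \<phi>(a) \<psi>(b)\<close>.\<close>

definition tens_form ::
  "('k::field_char_0 ncp_alg \<Rightarrow> 'k) \<Rightarrow> ('k ncp_alg \<Rightarrow> 'k) \<Rightarrow> 'k ncp_alg2 \<Rightarrow> 'k" where
  "tens_form \<phi> \<psi> t = (\<Sum>(a, b)\<in>Poly_Mapping.keys t. Poly_Mapping.lookup t (a, b) *
     (\<phi> (Poly_Mapping.single a 1) * \<psi> (Poly_Mapping.single b 1)))"

definition eps_delta :: "'k::field_char_0 ncp_alg \<Rightarrow> 'k" where
  "eps_delta = alg_ext (\<lambda>c. c) (\<lambda>\<pi>. if card (blocks \<pi>) = 1 then 1 else 0)"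

definition lambda_s :: "'k::field_char_0 ncp_alg \<Rightarrow> 'k" where
  "lambda_s = alg_ext (\<lambda>c. c) (\<lambda>\<pi>. if blocks \<pi> = Base \<pi> then 1 else 0)"

definition char_monoid :: "('k::field_char_0 ncp_alg \<Rightarrow> 'k) monoid" where
  "char_monoid = \<lparr>carrier = characters, mult = (\<lambda>\<phi> \<psi>. tens_form \<phi> \<psi> \<circ> delta),
     one = eps_delta\<rparr>"

definition mu_s :: "'k::field_char_0 ncp_alg \<Rightarrow> 'k" where
  "mu_s = inv\<^bsub>char_monoid\<^esub> lambda_s"

end

theory Submission
  imports Defs
begin

text \<open>Call a set of blocks flat if no block is nested in another one. A noncrossing partition
  equals its base if and only if it is flat, and then its blocks are intervals. Thus \<open>\<lambda>\<^sup>s\<close> is on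
  generators the indicator of flat partitions, and the claim is that its inverse is the character
  \<open>\<nu>\<close> that is \<open>(-1)\<^bsup>|\<pi>|-1\<^esup>\<close> on flat partitions and \<open>0\<close> on the others.

  In both convolutions \<open>\<lambda>\<^sup>s \<star> \<nu>\<close> and \<open>\<nu> \<star> \<lambda>\<^sup>s\<close> an equivalence \<open>\<sim>\<close> contributes only if
  \<open>\<pi>/\<sim>\<close> and the restrictions of \<open>\<pi>\<close> to the classes of \<open>\<sim>\<close> are all flat. This forces \<open>\<pi>\<close> to be
  flat: a nested pair of blocks would lie in one interval of \<open>\<pi>/\<sim>\<close>, hence in one class
  (\<open>flat_if_flat_quotient\<close>). For flat \<open>\<pi>\<close> with \<open>k\<close> blocks the restrictions are automatically flat,
  and the term of \<open>\<sim>\<close> with \<open>l\<close> classes is \<open>(-1)\<^bsup>k-l\<^esup>\<close> in the first convolution and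
  \<open>(-1)\<^bsup>l-1\<^esup>\<close> in the second. So both are, up to a global sign, the sum of \<open>(-1)\<^bsup>l\<^esup>\<close> over the
  interval partitions coarser than \<open>\<pi>\<close>. Such a partition is determined by the set of left end
  points of its intervals, which is any set of left end points of blocks of \<open>\<pi>\<close> that contains
  \<open>1\<close>; hence the sum is an alternating sum over subsets of a set of size \<open>k - 1\<close>, which vanishes
  unless \<open>k = 1\<close> (\<open>sum_sign_flat_equivs\<close>).

  The inverse in the monoid is defined by a description, so a right inverse must also be shown
  to be unique. In \<open>\<phi> \<star> \<psi>\<close> the value \<open>\<psi>(\<pi>)\<close> occurs in the term of the total relation only, with
  the value of \<open>\<phi>\<close> at a one-block partition as coefficient, which is \<open>1\<close> for \<open>\<phi> = \<lambda>\<^sup>s\<close>. All other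
  terms involve \<open>\<psi>\<close> at partitions with fewer blocks only, so \<open>\<psi>\<close> is determined by induction (\<open>right_inverse_unique\<close>).\<close>

section \<open>Characters and their convolution\<close>

lemma poly_mapping_expand:
  "p = (\<Sum>m\<in>Poly_Mapping.keys p. Poly_Mapping.single m (Poly_Mapping.lookup p m))"
  by (rule poly_mapping_eqI)
    (simp add: lookup_sum lookup_single when_def in_keys_iff)

text \<open>A morphism from a monoid into an algebra extends to the monoid algebra. The polynomial algebra
  is the case of the free commutative monoid; its tensor square, the case of the square of that
  monoid, so one construction serves both for the coproduct and for tensor products of
  characters.\<close>

locale monoid_algebra_ext =
  fixes \<iota> :: "'k::comm_ring_1 \<Rightarrow> 'a::comm_ring_1" and \<chi> :: "'m::comm_monoid_add \<Rightarrow> 'a"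
  assumes \<iota>_one: "\<iota> 1 = 1" and \<iota>_add: "\<iota> (a + b) = \<iota> a + \<iota> b" and \<iota>_mult: "\<iota> (a * b) = \<iota> a * \<iota> b"
    and \<chi>_zero: "\<chi> 0 = 1" and \<chi>_add: "\<chi> (m + n) = \<chi> m * \<chi> n"
begin

definition ext :: "('m \<Rightarrow>\<^sub>0 'k) \<Rightarrow> 'a" where
  "ext p = (\<Sum>m\<in>Poly_Mapping.keys p. \<iota> (Poly_Mapping.lookup p m) * \<chi> m)"

lemma \<iota>_zero: "\<iota> 0 = 0"
  using \<iota>_add[of 0 0] by simp

lemma ext_superset:
  assumes "finite A" "Poly_Mapping.keys p \<subseteq> A"
  shows "ext p = (\<Sum>m\<in>A. \<iota> (Poly_Mapping.lookup p m) * \<chi> m)"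
  unfolding ext_def using assms
  by (intro sum.mono_neutral_left) (auto simp: in_keys_iff \<iota>_zero)

lemma ext_single: "ext (Poly_Mapping.single m c) = \<iota> c * \<chi> m"
  by (subst ext_superset[of "{m}"]) auto

lemma ext_zero: "ext 0 = 0"
  by (simp add: ext_def)

lemma ext_one: "ext 1 = 1"
  unfolding single_one[symmetric] ext_single by (simp add: \<iota>_one \<chi>_zero)

lemma ext_add: "ext (p + q) = ext p + ext q"
proof -
  let ?A = "Poly_Mapping.keys p \<union> Poly_Mapping.keys q"
  have "ext (p + q) = (\<Sum>m\<in>?A. \<iota> (Poly_Mapping.lookup (p + q) m) * \<chi> m)"
    by (rule ext_superset) (use Poly_Mapping.keys_add[of p q] in auto)
  moreover have "ext p = (\<Sum>m\<in>?A. \<iota> (Poly_Mapping.lookup p m) * \<chi> m)"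
    "ext q = (\<Sum>m\<in>?A. \<iota> (Poly_Mapping.lookup q m) * \<chi> m)"
    by (rule ext_superset; simp)+
  ultimately show ?thesis
    by (simp add: lookup_add \<iota>_add distrib_right sum.distrib)
qed

lemma ext_sum: "ext (sum f A) = (\<Sum>x\<in>A. ext (f x))"
  by (induction A rule: infinite_finite_induct) (auto simp: ext_add ext_zero)

lemma ext_mult: "ext (p * q) = ext p * ext q"
proof -
  let ?s = "\<lambda>p m. Poly_Mapping.single m (Poly_Mapping.lookup p m)"
  have "p * q = (\<Sum>m\<in>Poly_Mapping.keys p. ?s p m) * (\<Sum>n\<in>Poly_Mapping.keys q. ?s q n)"
    by (simp flip: poly_mapping_expand)
  also have "ext \<dots> = (\<Sum>m\<in>Poly_Mapping.keys p. \<Sum>n\<in>Poly_Mapping.keys q. ext (?s p m) * ext (?s q n))"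
    by (simp add: sum_product ext_sum mult_single ext_single \<iota>_mult \<chi>_add mult_ac)
  also have "\<dots> = ext p * ext q"
    by (simp add: sum_product ext_single ext_def[of p] ext_def[of q])
  finally show ?thesis .
qed

end

lemma characters_add: "\<phi> \<in> characters \<Longrightarrow> \<phi> (p + q) = \<phi> p + \<phi> q"
  and characters_mult: "\<phi> \<in> characters \<Longrightarrow> \<phi> (p * q) = \<phi> p * \<phi> q"
  and characters_one: "\<phi> \<in> characters \<Longrightarrow> \<phi> 1 = 1"
  and characters_scale: "\<phi> \<in> characters \<Longrightarrow> \<phi> (Poly_Mapping.single 0 a * p) = a * \<phi> p"
  by (auto simp: characters_def)

lemma characters_zero: "\<phi> \<in> characters \<Longrightarrow> \<phi> 0 = 0"
  using characters_add[of \<phi> 0 0] by simp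

lemma characters_sum: "\<phi> \<in> characters \<Longrightarrow> \<phi> (sum f A) = (\<Sum>x\<in>A. \<phi> (f x))"
  by (induction A rule: infinite_finite_induct) (auto simp: characters_add characters_zero)

lemma characters_prod: "\<phi> \<in> characters \<Longrightarrow> \<phi> (prod f A) = (\<Prod>x\<in>A. \<phi> (f x))"
  by (induction A rule: infinite_finite_induct) (auto simp: characters_mult characters_one)

lemma characters_expand:
  assumes "\<phi> \<in> characters"
  shows "\<phi> p = (\<Sum>m\<in>Poly_Mapping.keys p. Poly_Mapping.lookup p m * \<phi> (Poly_Mapping.single m 1))"
proof -
  have *: "\<phi> (Poly_Mapping.single m c) = c * \<phi> (Poly_Mapping.single m 1)" for m c
    using characters_scale[OF assms, of c "Poly_Mapping.single m 1"] by (simp add: mult_single)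
  have "\<phi> p = (\<Sum>m\<in>Poly_Mapping.keys p. \<phi> (Poly_Mapping.single m (Poly_Mapping.lookup p m)))"
    by (subst (1) poly_mapping_expand) (rule characters_sum[OF assms])
  also have "\<dots> = (\<Sum>m\<in>Poly_Mapping.keys p. Poly_Mapping.lookup p m * \<phi> (Poly_Mapping.single m 1))"
    by (rule sum.cong[OF refl], rule *)
  finally show ?thesis .
qed

text \<open>Every basis element is a product of generators.\<close>

lemma characters_eqI:
  assumes \<phi>: "\<phi> \<in> characters" and \<psi>: "\<psi> \<in> characters"
    and gen: "\<And>\<pi>. \<phi> (gen \<pi>) = \<psi> (gen \<pi>)"
  shows "\<phi> = \<psi>"
proof
  fix p
  have "\<phi> (Poly_Mapping.single m 1) = \<psi> (Poly_Mapping.single m 1)" for m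
  proof (induction m)
    case empty
    then show ?case using \<phi> \<psi> by (simp add: characters_one)
  next
    case (add \<pi> m)
    have "Poly_Mapping.single (add_mset \<pi> m) 1 = gen \<pi> * Poly_Mapping.single m (1::'a)"
      by (simp add: gen_def mult_single)
    with add show ?case using \<phi> \<psi> gen by (simp add: characters_mult)
  qed
  then show "\<phi> p = \<psi> p"
    by (simp add: characters_expand[OF \<phi>, of p] characters_expand[OF \<psi>, of p])
qed

lemma alg_ext_hom:
  assumes "\<iota> 1 = 1" "\<And>a b. \<iota> (a + b) = \<iota> a + \<iota> b" "\<And>a b. \<iota> (a * b) = \<iota> a * \<iota> b"
  shows "monoid_algebra_ext \<iota> (\<lambda>m. \<Prod>\<pi>\<in>#m. f \<pi>)"
    and "alg_ext \<iota> f = monoid_algebra_ext.ext \<iota> (\<lambda>m. \<Prod>\<pi>\<in>#m. f \<pi>)"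
proof -
  show *: "monoid_algebra_ext \<iota> (\<lambda>m. \<Prod>\<pi>\<in>#m. f \<pi>)"
    by unfold_locales (simp_all add: assms)
  show "alg_ext \<iota> f = monoid_algebra_ext.ext \<iota> (\<lambda>m. \<Prod>\<pi>\<in>#m. f \<pi>)"
    by (rule ext) (simp add: monoid_algebra_ext.ext_def[OF *] alg_ext_def)
qed

lemma alg_ext_character: "alg_ext (\<lambda>c. c) f \<in> characters"
proof -
  interpret monoid_algebra_ext "\<lambda>c::'a. c" "\<lambda>m. \<Prod>\<pi>\<in>#m. f \<pi>"
    by (rule alg_ext_hom) auto
  have "alg_ext (\<lambda>c. c) f = ext"
    by (rule alg_ext_hom) auto
  then show ?thesis
    by (simp add: characters_def ext_add ext_mult ext_one ext_single)
qed

context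
  fixes \<phi> \<psi> :: "'k::field_char_0 ncp_alg \<Rightarrow> 'k"
  assumes \<phi>: "\<phi> \<in> characters" and \<psi>: "\<psi> \<in> characters"
begin

interpretation T: monoid_algebra_ext "\<lambda>c::'k. c"
  "\<lambda>(a, b). \<phi> (Poly_Mapping.single a 1) * \<psi> (Poly_Mapping.single b 1)"
proof -
  have "\<chi> (Poly_Mapping.single (m + n) 1) = \<chi> (Poly_Mapping.single m 1) * \<chi> (Poly_Mapping.single n 1)"
    if "\<chi> \<in> characters" for \<chi> :: "'k ncp_alg \<Rightarrow> 'k" and m n
    using characters_mult[OF that, of "Poly_Mapping.single m 1" "Poly_Mapping.single n 1"]
    by (simp add: mult_single)
  from this[OF \<phi>] this[OF \<psi>] \<phi> \<psi> show "monoid_algebra_ext (\<lambda>c::'k. c)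
      (\<lambda>(a, b). \<phi> (Poly_Mapping.single a 1) * \<psi> (Poly_Mapping.single b 1))"
    by unfold_locales (auto simp: characters_one zero_prod_def mult_ac)
qed

lemma tens_form_eq_ext: "tens_form \<phi> \<psi> = T.ext"
  by (rule ext) (auto simp: tens_form_def T.ext_def intro!: sum.cong)

lemma tens_form_tens: "tens_form \<phi> \<psi> (tens p q) = \<phi> p * \<psi> q"
  by (simp add: tens_form_eq_ext tens_def T.ext_sum T.ext_single sum_product mult_ac
      characters_expand[OF \<phi>, of p] characters_expand[OF \<psi>, of q])

text \<open>Makes the convolution computable on generators alone, through \<open>characters_eqI\<close>.\<close>

lemma convolution_character: "tens_form \<phi> \<psi> \<circ> delta \<in> characters"
proof -
  let ?f = "\<lambda>\<pi>. \<Sum>r\<in>Ec \<pi>. tens (gen (ncp_quot \<pi> r)) (\<Prod>C\<in>blocks \<pi> // r. gen (restr C)) :: 'k ncp_alg2"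
  interpret D: monoid_algebra_ext "Poly_Mapping.single 0 :: 'k \<Rightarrow> 'k ncp_alg2" "\<lambda>m. \<Prod>\<pi>\<in>#m. ?f \<pi>"
    by (rule alg_ext_hom) (auto simp: single_add mult_single)
  have D: "delta = D.ext"
    unfolding delta_def by (rule alg_ext_hom) (auto simp: single_add mult_single)
  have "T.ext (Poly_Mapping.single 0 a) = a" for a
    using T.\<chi>_zero by (simp add: T.ext_single)
  then show ?thesis
    by (simp add: characters_def D tens_form_eq_ext D.ext_add D.ext_mult D.ext_one D.ext_single
        T.ext_add T.ext_mult T.ext_one)
qed

text \<open>The coproduct of a generator is a sum of pure tensors, on which the form of \<open>\<phi>\<close> and \<open>\<psi>\<close> factors.\<close>

lemma convolution_gen:
  "tens_form \<phi> \<psi> (delta (gen \<pi>)) =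
     (\<Sum>r\<in>Ec \<pi>. \<phi> (gen (ncp_quot \<pi> r)) * (\<Prod>C\<in>blocks \<pi> // r. \<psi> (gen (restr C))))"
proof -
  have "delta (gen \<pi>) = (\<Sum>r\<in>Ec \<pi>. tens (gen (ncp_quot \<pi> r))
      (\<Prod>C\<in>blocks \<pi> // r. gen (restr C)) :: 'k ncp_alg2)"
    unfolding delta_def by (rule alg_ext_gen) simp
  also have "tens_form \<phi> \<psi> \<dots> = (\<Sum>r\<in>Ec \<pi>. tens_form \<phi> \<psi>
      (tens (gen (ncp_quot \<pi> r)) (\<Prod>C\<in>blocks \<pi> // r. gen (restr C))))"
    by (simp add: tens_form_eq_ext T.ext_sum)
  finally show ?thesis
    by (simp add: tens_form_tens characters_prod[OF \<psi>])
qed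

end

section \<open>Flat partitions\<close>

text \<open>The condition \<open>\<pi> = Base(\<pi>)\<close>, freed from the type of noncrossing partitions so that it also
  applies to classes of blocks and to merged blocks.\<close>

definition flat :: "nat set set \<Rightarrow> bool" where
  "flat P \<longleftrightarrow> (\<forall>b\<in>P. \<forall>b'\<in>P. nest_le b' b \<longrightarrow> b' = b)"

lemma blocks_eq_Base_iff_flat: "blocks \<pi> = Base \<pi> \<longleftrightarrow> flat (blocks \<pi>)"
  unfolding Base_def flat_def by blast

definition convex_blocks :: "nat set set \<Rightarrow> bool" where
  "convex_blocks P \<longleftrightarrow> (\<forall>b\<in>P. \<forall>x\<in>b. \<forall>z\<in>b. {x..z} \<subseteq> b)"

lemma convex_blocksD:
  "convex_blocks P \<Longrightarrow> b \<in> P \<Longrightarrow> x \<in> b \<Longrightarrow> z \<in> b \<Longrightarrow> x \<le> y \<Longrightarrow> y \<le> z \<Longrightarrow> y \<in> b"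
  unfolding convex_blocks_def by (meson atLeastAtMost_iff subsetD)

lemma partition_block:
  assumes "partition_on {1..n::nat} P" "b \<in> P"
  shows "finite b" "b \<noteq> {}" "Min b \<in> b" "Max b \<in> b"
proof -
  have "b \<subseteq> {1..n}"
    using assms by (auto simp: partition_on_def)
  then show "finite b" by (rule finite_subset) simp
  moreover show "b \<noteq> {}" using assms by (auto simp: partition_on_def)
  ultimately show "Min b \<in> b" "Max b \<in> b" by simp_all
qed

lemma Min_block_in: "partition_on {1..n::nat} P \<Longrightarrow> b \<in> P \<Longrightarrow> Min b \<in> {1..n}"
  using partition_block(3)[of n P b] partition_onD1[of "{1..n}" P] by auto

lemma partition_block_unique:
  "partition_on A P \<Longrightarrow> b \<in> P \<Longrightarrow> b' \<in> P \<Longrightarrow> x \<in> b \<Longrightarrow> x \<in> b' \<Longrightarrow> b = b'"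
  by (auto simp: partition_on_def disjoint_def)

lemma partition_block_exists:
  "partition_on A P \<Longrightarrow> x \<in> A \<Longrightarrow> \<exists>b\<in>P. x \<in> b"
  by (auto simp: partition_on_def)

lemma noncrossing_if_convex:
  assumes "partition_on {1..n} P" "convex_blocks P"
  shows "noncrossing P"
  unfolding noncrossing_def
proof (intro notI, elim bexE conjE exE)
  fix b b' x y z t
  assume b: "b \<in> P" "b' \<in> P" "b \<noteq> b'" and x: "x \<in> b" "z \<in> b" "y \<in> b'" "x < y" "y < z"
  have "y \<in> b" by (rule convex_blocksD[OF assms(2) b(1) x(1,2)]) (use x in simp_all)
  with b x show False using partition_block_unique[OF assms(1)] by blast
qed

lemma flat_if_convex:
  assumes "partition_on {1..n} P" "convex_blocks P"
  shows "flat P"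
  unfolding flat_def
proof (intro ballI impI)
  fix b b' assume b: "b \<in> P" "b' \<in> P" "nest_le b' b"
  have "Min b \<in> b" using partition_block[OF assms(1) b(1)] by simp
  moreover from this have "Min b \<in> b'"
    using convex_blocksD[OF assms(2) b(2) partition_block(3,4)[OF assms(1) b(2)]] b(3)
    unfolding nest_le_def by (meson atLeastAtMost_iff subsetD)
  ultimately show "b' = b" using partition_block_unique[OF assms(1)] b by metis
qed

text \<open>If \<open>y\<close> in another block \<open>b'\<close> separates two elements of \<open>b\<close>, then an element of \<open>b'\<close> outside the
  hull of \<open>b\<close> would make \<open>b\<close> and \<open>b'\<close> cross, so \<open>b'\<close> is nested in \<open>b\<close>.\<close>

lemma convex_if_flat:
  assumes P: "partition_on {1..n} P" and nc: "noncrossing P" and flat: "flat P"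
  shows "convex_blocks P"
  unfolding convex_blocks_def
proof (intro ballI subsetI)
  fix b x y z assume b: "b \<in> P" "x \<in> b" "z \<in> b" and y: "y \<in> {x..z}"
  have sub: "b \<subseteq> {1..n}" using P b by (auto simp: partition_on_def)
  then have "y \<in> {1..n}" using b y by auto
  then obtain b' where b': "b' \<in> P" "y \<in> b'"
    using partition_block_exists[OF P] by blast
  show "y \<in> b"
  proof (rule ccontr)
    assume "y \<notin> b"
    then have ne: "b \<noteq> b'" "x < y" "y < z" using b b' y by (auto simp: order_le_less)
    note Pb = partition_block[OF P b(1)]
    have m: "Min b \<le> x" "z \<le> Max b" using b Pb by auto
    have "t \<in> {Min b..Max b}" if t: "t \<in> b'" for t
    proof (rule ccontr)
      assume "t \<notin> {Min b..Max b}"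
      then consider "t < Min b" | "Max b < t" by fastforce
      then show False
      proof cases
        case 1
        have "Min b < y" using m ne by simp
        with 1 ne t b b' Pb nc show False unfolding noncrossing_def by metis
      next
        case 2
        have "y < Max b" using m ne by simp
        with 2 ne t b b' Pb nc show False unfolding noncrossing_def by metis
      qed
    qed
    then have "nest_le b b'" by (auto simp: nest_le_def)
    with flat b b' ne show False unfolding flat_def by blast
  qed
qed

lemma blocks_partition:
  obtains n where "n \<ge> 1" "partition_on {1..n} (blocks \<pi>)" "noncrossing (blocks \<pi>)"
  using blocks[of \<pi>] by (auto simp: NCP_def)

lemma finite_blocks: "finite (blocks \<pi>)"
proof -
  obtain n where "partition_on {1..n} (blocks \<pi>)" by (rule blocks_partition)
  then show ?thesis by (rule finite_elements[rotated]) simp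
qed

lemma inj_on_image_subsets:
  assumes "inj_on f (\<Union>Y)"
  shows "inj_on ((`) f) Y"
proof (rule inj_onI)
  fix a b assume "a \<in> Y" "b \<in> Y" "f ` a = f ` b"
  then show "a = b"
    using inj_on_image_eq_iff[OF assms, of a b] by (simp add: Union_upper)
qed

text \<open>Restriction renumbers the points by an increasing bijection, which preserves nesting.\<close>

lemma
  assumes Y: "Y \<subseteq> blocks \<pi>" "Y \<noteq> {}"
  shows card_blocks_restr: "card (blocks (restr Y)) = card Y"
    and flat_restr: "flat (blocks (restr Y)) \<longleftrightarrow> flat Y"
proof -
  obtain n where P: "partition_on {1..n} (blocks \<pi>)" by (rule blocks_partition)
  let ?S = "\<Union>Y"
  have "?S \<subseteq> {1..n}" using P Y by (auto simp: partition_on_def)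
  then have fin: "finite ?S" by (rule finite_subset) simp
  have inj: "inj_on ((`) (rank_in ?S)) Y"
    by (intro inj_on_image_subsets bij_betw_imp_inj_on[OF rank_in_bij] fin)
  then show "card (blocks (restr Y)) = card Y"
    unfolding blocks_restr[OF Y] standardize_def by (rule card_image)
  \<comment> \<open>Renumbering is monotone on all numbers, so it commutes with \<open>Min\<close> and \<open>Max\<close>.\<close>
  have mono: "mono (rank_in ?S)"
    unfolding rank_in_def using fin by (intro monoI card_mono) auto
  have nest: "nest_le (rank_in ?S ` b') (rank_in ?S ` b) \<longleftrightarrow> nest_le b' b" if b: "b \<in> Y" "b' \<in> Y" for b b'
  proof -
    note B' = partition_block[OF P, of b']
    have "b' \<in> blocks \<pi>" using b Y by auto
    note B' = B'[OF this]
    have M: "Min (rank_in ?S ` b') = rank_in ?S (Min b')" "Max (rank_in ?S ` b') = rank_in ?S (Max b')"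
      using mono_Min_commute[OF mono B'(1,2)] mono_Max_commute[OF mono B'(1,2)] by simp_all
    have le: "rank_in ?S x \<le> rank_in ?S y \<longleftrightarrow> x \<le> y" if "x \<in> ?S" "y \<in> ?S" for x y
      using rank_in_less_iff[OF fin that(2,1)] by (simp add: not_less[symmetric])
    have "Min b' \<in> ?S" "Max b' \<in> ?S" using b B' by blast+
    then have "rank_in ?S (Min b') \<le> rank_in ?S x \<longleftrightarrow> Min b' \<le> x"
      "rank_in ?S x \<le> rank_in ?S (Max b') \<longleftrightarrow> x \<le> Max b'" if "x \<in> b" for x
      using b that le by blast+
    then show ?thesis
      by (simp add: nest_le_def M image_subset_iff subset_eq[of b])
  qed
  have "rank_in ?S ` b' = rank_in ?S ` b \<longleftrightarrow> b' = b" if "b \<in> Y" "b' \<in> Y" for b b'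
    using inj_on_eq_iff[OF inj that(2,1)] .
  then show "flat (blocks (restr Y)) \<longleftrightarrow> flat Y"
    unfolding blocks_restr[OF Y] standardize_def flat_def by (simp add: nest)
qed

lemma class_subset: "equiv A r \<Longrightarrow> C \<in> A // r \<Longrightarrow> C \<subseteq> A \<and> C \<noteq> {}"
  using in_quotient_imp_subset[of A r C] in_quotient_imp_non_empty[of A r C] by simp

lemma partition_merge_blocks:
  assumes r: "r \<in> Ec \<pi>" and P: "partition_on {1..n} (blocks \<pi>)"
  shows "partition_on {1..n} (merge_blocks \<pi> r)"
proof -
  obtain m where m: "partition_on {1..m} (blocks (ncp_quot \<pi> r))" by (rule blocks_partition)
  have eq: "equiv (blocks \<pi>) r" using r by (simp add: Ec_def)
  have "\<Union>(merge_blocks \<pi> r) = \<Union>(\<Union>(blocks \<pi> // r))"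
    unfolding merge_blocks_def by blast
  also have "\<dots> = {1..n}"
    unfolding Union_quotient[OF eq] using P by (simp add: partition_on_def)
  finally have "{1..m} = {1..n}"
    using partition_onD1[OF m] by (simp add: blocks_ncp_quot[OF r])
  with m show ?thesis unfolding blocks_ncp_quot[OF r] by metis
qed

text \<open>If \<open>b\<close> is nested in \<open>b'\<close>, then \<open>b\<close> meets the interval of the flat quotient that contains
  \<open>b'\<close>. Hence \<open>b\<close> and \<open>b'\<close> are in the same class, which by assumption contains no nested pair.\<close>

lemma flat_if_flat_quotient:
  assumes r: "r \<in> Ec \<pi>" and Q: "flat (merge_blocks \<pi> r)"
    and C: "\<And>C. C \<in> blocks \<pi> // r \<Longrightarrow> flat C"
  shows "flat (blocks \<pi>)"
  unfolding flat_def
proof (intro ballI impI)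
  fix b b' assume b: "b \<in> blocks \<pi>" "b' \<in> blocks \<pi>" "nest_le b' b"
  obtain n where P: "partition_on {1..n} (blocks \<pi>)" by (rule blocks_partition)
  have eq: "equiv (blocks \<pi>) r" and nc: "noncrossing (merge_blocks \<pi> r)"
    using r by (simp_all add: Ec_def)
  note PQ = partition_merge_blocks[OF r P]
  note conv = convex_if_flat[OF PQ nc Q]
  let ?C = "r `` {b'}"
  have C': "?C \<in> blocks \<pi> // r" using b by (simp add: quotientI)
  then have B: "\<Union>?C \<in> merge_blocks \<pi> r" by (simp add: merge_blocks_def)
  have self: "b' \<in> ?C" using equiv_class_self[OF eq b(2)] .
  then have M: "Min b' \<in> \<Union>?C" "Max b' \<in> \<Union>?C"
    using partition_block[OF P b(2)] by blast+
  have "Min b \<in> {Min b'..Max b'}"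
    using b(3) partition_block(3)[OF P b(1)] unfolding nest_le_def by (rule subsetD)
  then have "Min b \<in> \<Union>?C"
    by (intro convex_blocksD[OF conv B M]) simp_all
  then obtain b'' where b'': "b'' \<in> ?C" "Min b \<in> b''" by (rule UnionE)
  have "b'' \<in> blocks \<pi>" using class_subset[OF eq C'] b''(1) by blast
  then have "b'' = b"
    by (rule partition_block_unique[OF P _ b(1) b''(2) partition_block(3)[OF P b(1)]])
  with b'' self b C[OF C'] show "b' = b" by (auto simp: flat_def)
qed

section \<open>Interval partitions coarser than a flat partition\<close>

text \<open>For the set \<open>K\<close> of left end points of an interval partition, this is the left end point of the
  interval that contains \<open>x\<close>.\<close>

definition start :: "nat set \<Rightarrow> nat \<Rightarrow> nat" where
  "start K x = Max {m \<in> K. m \<le> x}"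

lemma start_in:
  assumes "m \<in> K" "m \<le> x"
  shows "start K x \<in> K" "start K x \<le> x" "m \<le> start K x"
proof -
  have "finite {m \<in> K. m \<le> x}" by (rule finite_subset[of _ "{..x}"]) auto
  moreover have "m \<in> {m \<in> K. m \<le> x}" using assms by simp
  ultimately show "start K x \<in> K" "start K x \<le> x" "m \<le> start K x"
    unfolding start_def using Max_in[of "{m \<in> K. m \<le> x}"] Max_ge[of "{m \<in> K. m \<le> x}"] by blast+
qed

lemma start_fixed: "s \<in> K \<Longrightarrow> start K s = s"
  using start_in[of s K s] by simp

lemma start_mono: "m \<in> K \<Longrightarrow> m \<le> x \<Longrightarrow> x \<le> y \<Longrightarrow> start K x \<le> start K y"
  using start_in[of m K x] start_in(3)[of "start K x" K y] by auto

lemma start_Min: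
  assumes P: "partition_on {1..n} P" and conv: "convex_blocks P" and B: "B \<in> P" "x \<in> B"
  shows "start (Min ` P) x = Min B"
proof -
  have "Min B \<le> x" using partition_block[OF P B(1)] B by simp
  then have s: "start (Min ` P) x \<in> Min ` P" "start (Min ` P) x \<le> x" "Min B \<le> start (Min ` P) x"
    using start_in[of "Min B" "Min ` P" x] B by auto
  then obtain B' where B': "B' \<in> P" "start (Min ` P) x = Min B'" by blast
  have "Min B' \<in> B"
    by (rule convex_blocksD[OF conv B(1) partition_block(3)[OF P B(1)] B(2)]) (use s B' in simp_all)
  then have "B' = B"
    by (rule partition_block_unique[OF P B'(1) B(1) partition_block(3)[OF P B'(1)]])
  with B' show ?thesis by simp
qed

lemma inj_on_Min_blocks: "partition_on {1..n::nat} P \<Longrightarrow> inj_on Min P"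
  by (rule inj_onI) (use partition_block(3) partition_block_unique in fastforce)

text \<open>The equivalence that merges the blocks of \<open>P\<close> into intervals with left end points \<open>K\<close>.\<close>

definition start_rel :: "nat set set \<Rightarrow> nat set \<Rightarrow> (nat set \<times> nat set) set" where
  "start_rel P K = {(b, b'). b \<in> P \<and> b' \<in> P \<and> start K (Min b) = start K (Min b')}"

lemma equiv_start_rel: "equiv P (start_rel P K)"
  by (rule equivI) (auto simp: start_rel_def refl_on_def sym_def trans_def)

text \<open>For flat \<open>\<pi>\<close> these are the equivalences that contribute to the two convolutions.\<close>

definition flat_equivs :: "ncp \<Rightarrow> (nat set \<times> nat set) set set" where
  "flat_equivs \<pi> = {r \<in> Ec \<pi>. flat (merge_blocks \<pi> r)}"

context
  fixes \<pi> :: ncp and n :: nat and r :: "(nat set \<times> nat set) set"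
  assumes P: "partition_on {1..n} (blocks \<pi>)" and r: "r \<in> flat_equivs \<pi>"
begin

lemma
  shows merge_equiv: "equiv (blocks \<pi>) r"
    and merge_partition: "partition_on {1..n} (merge_blocks \<pi> r)"
    and merge_convex: "convex_blocks (merge_blocks \<pi> r)"
  using r partition_merge_blocks[OF _ P] convex_if_flat by (auto simp: flat_equivs_def Ec_def)

lemma Union_class_inject:
  assumes C: "C \<in> blocks \<pi> // r" "D \<in> blocks \<pi> // r" and x: "x \<in> \<Union>C" "x \<in> \<Union>D"
  shows "C = D"
proof -
  obtain b b' where "b \<in> C" "x \<in> b" "b' \<in> D" "x \<in> b'" using x by blast
  moreover from this have "b = b'"
    using class_subset[OF merge_equiv] C partition_block_unique[OF P] by blast
  ultimately show ?thesis using quotient_disj[OF merge_equiv C] by blast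
qed

lemma card_starts: "card (Min ` merge_blocks \<pi> r) = card (blocks \<pi> // r)"
proof -
  have "inj_on Union (blocks \<pi> // r)"
  proof (rule inj_onI)
    fix C D assume CD: "C \<in> blocks \<pi> // r" "D \<in> blocks \<pi> // r" "\<Union>C = \<Union>D"
    then have "\<Union>C \<in> merge_blocks \<pi> r" by (simp add: merge_blocks_def)
    then have "\<Union>C \<noteq> {}" using partition_block(2)[OF merge_partition] by blast
    with CD show "C = D" using Union_class_inject by blast
  qed
  then show ?thesis
    using card_image[OF inj_on_Min_blocks[OF merge_partition]] by (simp add: merge_blocks_def card_image)
qed

lemma starts_subset: "Min ` merge_blocks \<pi> r \<subseteq> Min ` blocks \<pi>"
proof (rule image_subsetI)
  fix B assume B: "B \<in> merge_blocks \<pi> r"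
  then obtain C where C: "C \<in> blocks \<pi> // r" "B = \<Union>C" by (auto simp: merge_blocks_def)
  note PB = partition_block[OF merge_partition B]
  then obtain b where b: "b \<in> C" "Min B \<in> b" using C by auto
  then have "b \<in> blocks \<pi>" using class_subset[OF merge_equiv] C by blast
  moreover have "Min b = Min B"
  proof (rule Min_eqI)
    show "finite b" using partition_block[OF P \<open>b \<in> blocks \<pi>\<close>] by simp
    show "Min B \<le> y" if "y \<in> b" for y
      by (rule Min_le[OF PB(1)]) (use that b C in auto)
  qed (use b in simp)
  ultimately show "Min B \<in> Min ` blocks \<pi>" by (metis imageI)
qed

lemma one_start:
  assumes "n \<ge> 1"
  shows "1 \<in> Min ` merge_blocks \<pi> r"
proof -
  obtain B where B: "B \<in> merge_blocks \<pi> r" "1 \<in> B"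
    using partition_block_exists[OF merge_partition, of 1] assms by auto
  have "Min B = 1"
  proof (rule Min_eqI)
    show "finite B" using partition_block[OF merge_partition B(1)] by simp
    show "1 \<le> y" if "y \<in> B" for y
      using that B merge_partition by (auto simp: partition_on_def)
  qed (use B in simp)
  with B show ?thesis by (metis imageI)
qed

text \<open>Blocks are equivalent if and only if they lie in the same merged interval, that is, if the
  intervals that contain them have the same left end point. With \<open>starts_start_rel\<close> below this
  gives the bijection between the equivalences and the sets of left end points.\<close>

lemma start_rel_starts: "start_rel (blocks \<pi>) (Min ` merge_blocks \<pi> r) = r"
proof -
  let ?B = "\<lambda>b. \<Union>(r `` {b})"
  have cl: "r `` {b} \<in> blocks \<pi> // r" "?B b \<in> merge_blocks \<pi> r" "Min b \<in> ?B b"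
    if "b \<in> blocks \<pi>" for b
  proof -
    show "r `` {b} \<in> blocks \<pi> // r" using that by (rule quotientI)
    then show "?B b \<in> merge_blocks \<pi> r" by (simp add: merge_blocks_def)
    show "Min b \<in> ?B b"
      by (rule UnionI[OF equiv_class_self[OF merge_equiv that] partition_block(3)[OF P that]])
  qed
  have st: "start (Min ` merge_blocks \<pi> r) (Min b) = Min (?B b)" if "b \<in> blocks \<pi>" for b
    by (rule start_Min[OF merge_partition merge_convex]) (use cl[OF that] in auto)
  have iff: "Min (?B b) = Min (?B b') \<longleftrightarrow> (b, b') \<in> r" if b: "b \<in> blocks \<pi>" "b' \<in> blocks \<pi>" for b b'
  proof
    assume "Min (?B b) = Min (?B b')"
    then have "?B b = ?B b'"
      by (rule inj_onD[OF inj_on_Min_blocks[OF merge_partition] _ cl(2)[OF b(1)] cl(2)[OF b(2)]])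
    then have "r `` {b} = r `` {b'}"
      using Union_class_inject[OF cl(1)[OF b(1)] cl(1)[OF b(2)] cl(3)[OF b(1)]] cl(3)[OF b(1)] by simp
    then show "(b, b') \<in> r" by (rule eq_equiv_class[OF _ merge_equiv b(2)])
  next
    assume "(b, b') \<in> r"
    then show "Min (?B b) = Min (?B b')" using equiv_class_eq[OF merge_equiv] by simp
  qed
  have "r \<subseteq> blocks \<pi> \<times> blocks \<pi>" using merge_equiv by (rule equiv_type)
  then show ?thesis by (auto simp: start_rel_def st iff)
qed

end

context
  fixes \<pi> :: ncp and n :: nat and K :: "nat set"
  assumes P: "partition_on {1..n} (blocks \<pi>)" and flat: "convex_blocks (blocks \<pi>)"
    and K: "1 \<in> K" "K \<subseteq> Min ` blocks \<pi>"
begin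

text \<open>No element of \<open>K\<close> lies inside a block to the right of its minimum: it would be the minimum of
  that block.\<close>

lemma start_block:
  assumes b: "b \<in> blocks \<pi>" "x \<in> b"
  shows "start K x = start K (Min b)"
proof -
  have "m \<le> x \<longleftrightarrow> m \<le> Min b" if m: "m \<in> K" for m
    using start_in(3)[of m "Min ` blocks \<pi>" x] start_Min[OF P flat b] m K
      partition_block[OF P b(1)] b(2) by (auto intro: order_trans[OF _ Min_le])
  then have "{m \<in> K. m \<le> x} = {m \<in> K. m \<le> Min b}" by blast
  then show ?thesis by (simp add: start_def)
qed

lemma K_subset: "K \<subseteq> {1..n}"
proof
  fix m assume "m \<in> K"
  then obtain b where "b \<in> blocks \<pi>" "m = Min b" using K by blast
  then show "m \<in> {1..n}" using Min_block_in[OF P] by simp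
qed

text \<open>The merged blocks are the fibres of the monotone map \<open>start K\<close>, so they are intervals.\<close>

lemma merge_start_rel:
  "merge_blocks \<pi> (start_rel (blocks \<pi>) K) = (\<lambda>s. {x \<in> {1..n}. start K x = s}) ` K"
proof -
  let ?r = "start_rel (blocks \<pi>) K" and ?L = "\<lambda>s. {x \<in> {1..n}. start K x = s}"
  have U: "\<Union>(?r `` {b}) = ?L (start K (Min b))" if b: "b \<in> blocks \<pi>" for b
  proof (rule equalityI; rule subsetI)
    fix x assume "x \<in> \<Union>(?r `` {b})"
    then obtain b' where "b' \<in> blocks \<pi>" "x \<in> b'" "start K (Min b) = start K (Min b')"
      by (auto simp: start_rel_def)
    then show "x \<in> ?L (start K (Min b))"
      using P start_block[of b' x] by (auto simp: partition_on_def)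
  next
    fix x assume x: "x \<in> ?L (start K (Min b))"
    then obtain b' where "b' \<in> blocks \<pi>" "x \<in> b'"
      using partition_block_exists[OF P] by blast
    with x b start_block show "x \<in> \<Union>(?r `` {b})" by (auto simp: start_rel_def)
  qed
  have "(\<lambda>b. start K (Min b)) ` blocks \<pi> = K"
  proof
    show "(\<lambda>b. start K (Min b)) ` blocks \<pi> \<subseteq> K"
    proof (rule image_subsetI)
      fix b assume b: "b \<in> blocks \<pi>"
      then have "1 \<le> Min b" using Min_block_in[OF P b] by simp
      with K show "start K (Min b) \<in> K" by (metis start_in(1))
    qed
    show "K \<subseteq> (\<lambda>b. start K (Min b)) ` blocks \<pi>"
    proof
      fix m assume m: "m \<in> K"
      then obtain b where "b \<in> blocks \<pi>" "m = Min b" using K by blast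
      with start_fixed[OF m] show "m \<in> (\<lambda>b. start K (Min b)) ` blocks \<pi>" by (metis imageI)
    qed
  qed
  moreover have "merge_blocks \<pi> ?r = (\<lambda>b. \<Union>(?r `` {b})) ` blocks \<pi>"
    by (auto simp: merge_blocks_def quotient_def)
  moreover have "\<dots> = ?L ` (\<lambda>b. start K (Min b)) ` blocks \<pi>"
    using U by (simp add: image_image)
  ultimately show ?thesis by simp
qed

lemma partition_merge_start_rel:
  "partition_on {1..n} (merge_blocks \<pi> (start_rel (blocks \<pi>) K))"
  unfolding merge_start_rel
proof (rule partition_onI)
  show "\<Union> ((\<lambda>s. {x \<in> {1..n}. start K x = s}) ` K) = {1..n}"
    using start_in(1)[OF K(1)] by auto
  show "{} \<notin> (\<lambda>s. {x \<in> {1..n}. start K x = s}) ` K"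
    using K_subset start_fixed[of _ K] by fastforce
qed (auto simp: disjnt_def)

lemma start_rel_in_flat_equivs: "start_rel (blocks \<pi>) K \<in> flat_equivs \<pi>"
proof -
  have "convex_blocks (merge_blocks \<pi> (start_rel (blocks \<pi>) K))"
    unfolding merge_start_rel convex_blocks_def
  proof (intro ballI subsetI, elim imageE)
    fix B x z y s assume *: "x \<in> B" "z \<in> B" "y \<in> {x..z}" "B = {x \<in> {1..n}. start K x = s}"
    then have "1 \<le> x" "1 \<le> y" "x \<le> y" "y \<le> z" "y \<le> n" by auto
    then have "start K x \<le> start K y" "start K y \<le> start K z"
      using start_mono[OF K(1)] by auto
    with * \<open>1 \<le> y\<close> \<open>y \<le> n\<close> show "y \<in> B" by auto
  qed
  then show ?thesis
    using noncrossing_if_convex[OF partition_merge_start_rel] flat_if_convex[OF partition_merge_start_rel]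
    by (simp add: flat_equivs_def Ec_def equiv_start_rel)
qed

lemma starts_start_rel: "Min ` merge_blocks \<pi> (start_rel (blocks \<pi>) K) = K"
proof -
  have "Min {x \<in> {1..n}. start K x = s} = s" if s: "s \<in> K" for s
  proof (rule Min_eqI)
    fix y assume "y \<in> {x \<in> {1..n}. start K x = s}"
    then show "s \<le> y" using start_in(2)[OF K(1), of y] by auto
  qed (use s K_subset start_fixed[OF s] in auto)
  then show ?thesis by (force simp: merge_start_rel image_image)
qed

end

text \<open>Under the bijection with sets of left end points, the number of classes becomes the cardinality,
  and for the set \<open>M\<close> of minima of the blocks of \<open>\<pi>\<close>, as many sets \<open>K\<close> with \<open>{1} \<subseteq> K \<subseteq> M\<close> have even
  as have odd cardinality unless \<open>M = {1}\<close>.\<close>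

lemma sum_sign_flat_equivs:
  assumes flat: "flat (blocks \<pi>)"
  shows "(\<Sum>r\<in>flat_equivs \<pi>. (- 1) ^ card (blocks \<pi> // r)) =
    (if card (blocks \<pi>) = 1 then - 1 else 0 :: 'a::ring_1)"
proof -
  obtain n where n: "n \<ge> 1" and P: "partition_on {1..n} (blocks \<pi>)" and nc: "noncrossing (blocks \<pi>)"
    by (rule blocks_partition)
  note conv = convex_if_flat[OF P nc flat]
  let ?M = "Min ` blocks \<pi>" and ?T = "{K. K \<subseteq> Min ` blocks \<pi> \<and> {1} \<subseteq> K}"
  have sum: "(\<Sum>r\<in>flat_equivs \<pi>. (- 1) ^ card (blocks \<pi> // r)) = (\<Sum>K\<in>?T. (- 1) ^ card K :: 'a)"
    by (rule sum.reindex_bij_witness[where i = "start_rel (blocks \<pi>)" and j = "\<lambda>r. Min ` merge_blocks \<pi> r"])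
      (use start_rel_starts[OF P] starts_subset[OF P] one_start[OF P _ n] card_starts[OF P]
        start_rel_in_flat_equivs[OF P conv] starts_start_rel[OF P conv] in auto)
  have card: "card ?M = card (blocks \<pi>)"
    by (rule card_image[OF inj_on_Min_blocks[OF P]])
  have one: "1 \<in> ?M"
  proof -
    obtain b where b: "b \<in> blocks \<pi>" "1 \<in> b" using partition_block_exists[OF P, of 1] n by auto
    have "Min b \<in> {1..n}" by (rule Min_block_in[OF P b(1)])
    moreover have "Min b \<le> 1" using b partition_block(1)[OF P b(1)] by simp
    ultimately have "Min b = 1" by simp
    with b show ?thesis by (metis imageI)
  qed
  show ?thesis
  proof (cases "card (blocks \<pi>) = 1")
    case True
    then have "?M = {1}" using card one by (metis card_1_singletonE singletonD)
    then have "?T = {{1}}" by auto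
    with True sum show ?thesis by simp
  next
    case False
    have fin: "finite ?M" by (simp add: finite_blocks)
    have "{1} \<subset> ?M" using one False card by (metis One_nat_def card.empty card_insert_disjoint empty_iff empty_subsetI finite.emptyI insert_subset psubsetI)
    then have "card {T. T \<subseteq> ?M \<and> {1} \<subseteq> T \<and> even (card T)} = card {T. T \<subseteq> ?M \<and> {1} \<subseteq> T \<and> odd (card T)}"
      by (rule card_subsupersets_even_odd[OF fin])
    then have "(\<Sum>K\<in>?T. (- 1) ^ card K :: 'a) = 0"
      using fin by (intro sum_alternating_cancels) (auto simp: conj_assoc)
    with False sum show ?thesis by simp
  qed
qed

section \<open>The convolutions with the indicator of flat partitions\<close>

lemma card_blocks_ncp_quot:
  assumes "r \<in> flat_equivs \<pi>"
  shows "card (blocks (ncp_quot \<pi> r)) = card (blocks \<pi> // r)"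
proof -
  obtain n where P: "partition_on {1..n} (blocks \<pi>)" by (rule blocks_partition)
  have "card (merge_blocks \<pi> r) = card (Min ` merge_blocks \<pi> r)"
    by (rule card_image[symmetric, OF inj_on_Min_blocks[OF merge_partition[OF P assms]]])
  moreover have "r \<in> Ec \<pi>" using assms by (simp add: flat_equivs_def)
  ultimately show ?thesis by (simp add: blocks_ncp_quot card_starts[OF P assms])
qed

lemma finite_Ec: "finite (Ec \<pi>)"
proof (rule finite_subset)
  show "Ec \<pi> \<subseteq> Pow (blocks \<pi> \<times> blocks \<pi>)"
    using equiv_type by (auto simp: Ec_def)
qed (simp add: finite_blocks)

lemma flat_subset: "flat P \<Longrightarrow> C \<subseteq> P \<Longrightarrow> flat C"
  unfolding flat_def by blast

text \<open>The reduction common to both convolutions: terms with a nonflat quotient vanish, and if \<open>\<pi>\<close> is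
  not flat, then each remaining term has a vanishing factor.\<close>

lemma convolution_sum_flat_support:
  fixes f g :: "ncp \<Rightarrow> 'k::comm_ring_1"
  assumes f: "\<And>\<pi>. \<not> flat (blocks \<pi>) \<Longrightarrow> f \<pi> = 0" and g: "\<And>\<pi>. \<not> flat (blocks \<pi>) \<Longrightarrow> g \<pi> = 0"
  shows "(\<Sum>r\<in>Ec \<pi>. f (ncp_quot \<pi> r) * (\<Prod>C\<in>blocks \<pi> // r. g (restr C))) =
    (if flat (blocks \<pi>) then \<Sum>r\<in>flat_equivs \<pi>. f (ncp_quot \<pi> r) * (\<Prod>C\<in>blocks \<pi> // r. g (restr C)) else 0)"
proof -
  let ?t = "\<lambda>r. f (ncp_quot \<pi> r) * (\<Prod>C\<in>blocks \<pi> // r. g (restr C))"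
  have zero: "?t r = 0" if "r \<in> Ec \<pi>" "r \<notin> flat_equivs \<pi>" for r
    using that f[of "ncp_quot \<pi> r"] by (simp add: flat_equivs_def blocks_ncp_quot)
  have "sum ?t (Ec \<pi>) = sum ?t (flat_equivs \<pi>)"
    by (rule sum.mono_neutral_right) (use finite_Ec zero in \<open>auto simp: flat_equivs_def\<close>)
  moreover have "?t r = 0" if nf: "\<not> flat (blocks \<pi>)" and r: "r \<in> flat_equivs \<pi>" for r
  proof -
    have r': "r \<in> Ec \<pi>" "flat (merge_blocks \<pi> r)" "equiv (blocks \<pi>) r"
      using r by (simp_all add: flat_equivs_def Ec_def)
    then obtain C where C: "C \<in> blocks \<pi> // r" "\<not> flat C"
      using flat_if_flat_quotient nf by blast
    then have "g (restr C) = 0"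
      using g flat_restr class_subset[OF r'(3) C(1)] by blast
    moreover have "finite (blocks \<pi> // r)"
      using finite_blocks equiv_type[OF r'(3)] by (rule finite_quotient)
    ultimately show ?thesis using C(1) by (metis mult_zero_right prod_zero)
  qed
  ultimately show ?thesis by simp
qed

text \<open>The cardinalities of the classes add up to that of \<open>A\<close>, and each of the \<open>- 1\<close> in the exponents
  costs one sign.\<close>

lemma prod_sign_classes:
  assumes r: "equiv A r" and fin: "finite A"
  shows "(\<Prod>C\<in>A // r. (- 1) ^ (card C - 1) :: 'a::comm_ring_1) = (- 1) ^ card A * (- 1) ^ card (A // r)"
proof -
  have C: "finite C" "C \<noteq> {}" if "C \<in> A // r" for C
    using class_subset[OF r that] fin finite_subset by auto
  have "card (\<Union>(A // r)) = (\<Sum>C\<in>A // r. card C)"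
  proof (rule card_Union_disjoint)
    show "pairwise disjnt (A // r)"
      using quotient_disj[OF r] unfolding pairwise_def disjnt_def by metis
  qed (rule C)
  then have "card A = (\<Sum>C\<in>A // r. card C)"
    by (simp add: Union_quotient[OF r])
  then have "(- 1) ^ card A = (\<Prod>C\<in>A // r. (- 1) ^ card C :: 'a)"
    by (simp add: power_sum)
  moreover have "(- 1) ^ (card C - 1) = (- ((- 1) ^ card C) :: 'a)" if "C \<in> A // r" for C
    using C[OF that] by (cases "card C") auto
  ultimately show ?thesis by (simp add: prod_uminus mult.commute)
qed

definition flat_indicator :: "ncp \<Rightarrow> 'k::comm_ring_1" where
  "flat_indicator \<pi> = (if flat (blocks \<pi>) then 1 else 0)"

definition flat_sign :: "ncp \<Rightarrow> 'k::comm_ring_1" where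
  "flat_sign \<pi> = (if flat (blocks \<pi>) then (- 1) ^ (card (blocks \<pi>) - 1) else 0)"

lemma flat_if_card_one: "card P = 1 \<Longrightarrow> flat P"
  by (auto simp: card_1_singleton_iff flat_def)

lemma
  assumes r: "r \<in> flat_equivs \<pi>"
  shows flat_equivs_equiv: "equiv (blocks \<pi>) r"
    and flat_equivs_quot: "flat (blocks (ncp_quot \<pi> r))"
  using r by (simp_all add: flat_equivs_def Ec_def blocks_ncp_quot)

lemma flat_equivs_class:
  assumes flat: "flat (blocks \<pi>)" and r: "r \<in> flat_equivs \<pi>" and "C \<in> blocks \<pi> // r"
  shows "flat (blocks (restr C)) \<and> card (blocks (restr C)) = card C"
proof -
  have C: "C \<subseteq> blocks \<pi>" "C \<noteq> {}"
    using class_subset[OF flat_equivs_equiv[OF r]] assms(3) by blast+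
  show ?thesis
    using card_blocks_restr[OF C] flat_restr[OF C] flat_subset[OF flat C(1)] by simp
qed

text \<open>With \<open>k = |\<pi>|\<close>, the sign \<open>(-1)\<^bsup>k\<^esup>\<close> is common to all terms and compensates the \<open>- 1\<close> in
  \<open>sum_sign_flat_equivs\<close> when \<open>k = 1\<close>.\<close>

lemma indicator_sign_convolution:
  "(\<Sum>r\<in>Ec \<pi>. flat_indicator (ncp_quot \<pi> r) * (\<Prod>C\<in>blocks \<pi> // r. flat_sign (restr C))) =
    (if card (blocks \<pi>) = 1 then 1 else (0 :: 'k::comm_ring_1))"
proof (cases "flat (blocks \<pi>)")
  case False
  then show ?thesis
    using flat_if_card_one by (subst convolution_sum_flat_support) (auto simp: flat_indicator_def flat_sign_def)
next
  case True
  have "(\<Sum>r\<in>Ec \<pi>. flat_indicator (ncp_quot \<pi> r) * (\<Prod>C\<in>blocks \<pi> // r. flat_sign (restr C))) =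
    (\<Sum>r\<in>flat_equivs \<pi>. flat_indicator (ncp_quot \<pi> r) * (\<Prod>C\<in>blocks \<pi> // r. flat_sign (restr C) :: 'k))"
    using True by (subst convolution_sum_flat_support) (auto simp: flat_indicator_def flat_sign_def)
  also have "\<dots> = (\<Sum>r\<in>flat_equivs \<pi>. (- 1) ^ card (blocks \<pi>) * (- 1) ^ card (blocks \<pi> // r))"
  proof (rule sum.cong[OF refl])
    fix r assume r: "r \<in> flat_equivs \<pi>"
    have "(\<Prod>C\<in>blocks \<pi> // r. flat_sign (restr C)) = (\<Prod>C\<in>blocks \<pi> // r. (- 1) ^ (card C - 1) :: 'k)"
      by (rule prod.cong) (use flat_equivs_class[OF True r] in \<open>auto simp: flat_sign_def\<close>)
    also have "\<dots> = (- 1) ^ card (blocks \<pi>) * (- 1) ^ card (blocks \<pi> // r)"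
      by (rule prod_sign_classes[OF flat_equivs_equiv[OF r] finite_blocks])
    finally show "flat_indicator (ncp_quot \<pi> r) * (\<Prod>C\<in>blocks \<pi> // r. flat_sign (restr C)) =
        ((- 1) ^ card (blocks \<pi>) * (- 1) ^ card (blocks \<pi> // r) :: 'k)"
      by (simp add: flat_indicator_def flat_equivs_quot[OF r])
  qed
  also have "\<dots> = (if card (blocks \<pi>) = 1 then 1 else 0)"
    by (simp add: sum_distrib_left[symmetric] sum_sign_flat_equivs[OF True])
  finally show ?thesis .
qed

lemma sign_indicator_convolution:
  "(\<Sum>r\<in>Ec \<pi>. flat_sign (ncp_quot \<pi> r) * (\<Prod>C\<in>blocks \<pi> // r. flat_indicator (restr C))) =
    (if card (blocks \<pi>) = 1 then 1 else 0 :: 'k::comm_ring_1)"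
proof (cases "flat (blocks \<pi>)")
  case False
  then show ?thesis
    using flat_if_card_one by (subst convolution_sum_flat_support) (auto simp: flat_indicator_def flat_sign_def)
next
  case True
  have "(\<Sum>r\<in>Ec \<pi>. flat_sign (ncp_quot \<pi> r) * (\<Prod>C\<in>blocks \<pi> // r. flat_indicator (restr C))) =
    (\<Sum>r\<in>flat_equivs \<pi>. flat_sign (ncp_quot \<pi> r) * (\<Prod>C\<in>blocks \<pi> // r. flat_indicator (restr C) :: 'k))"
    using True by (subst convolution_sum_flat_support) (auto simp: flat_indicator_def flat_sign_def)
  also have "\<dots> = (\<Sum>r\<in>flat_equivs \<pi>. - ((- 1) ^ card (blocks \<pi> // r)))"
  proof (rule sum.cong[OF refl])
    fix r assume r: "r \<in> flat_equivs \<pi>"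
    have "(\<Prod>C\<in>blocks \<pi> // r. flat_indicator (restr C)) = (1 :: 'k)"
      by (rule prod.neutral) (use flat_equivs_class[OF True r] in \<open>auto simp: flat_indicator_def\<close>)
    moreover have "card (blocks \<pi> // r) \<noteq> 0"
    proof -
      have "finite (blocks (ncp_quot \<pi> r))" "blocks (ncp_quot \<pi> r) \<noteq> {}"
        using blocks_partition[of "ncp_quot \<pi> r"] finite_blocks by (auto simp: partition_on_def)
      then show ?thesis by (simp flip: card_blocks_ncp_quot[OF r])
    qed
    ultimately show "flat_sign (ncp_quot \<pi> r) * (\<Prod>C\<in>blocks \<pi> // r. flat_indicator (restr C)) =
        (- ((- 1) ^ card (blocks \<pi> // r)) :: 'k)"
      by (cases "card (blocks \<pi> // r)")
        (simp_all add: flat_sign_def flat_equivs_quot[OF r] card_blocks_ncp_quot[OF r])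
  qed
  also have "\<dots> = (if card (blocks \<pi>) = 1 then 1 else 0)"
    by (simp add: sum_negf sum_sign_flat_equivs[OF True])
  finally show ?thesis .
qed

section \<open>Uniqueness of the inverse and conclusion\<close>

text \<open>Needed to recognize \<open>\<psi>(\<pi>)\<close> in the term of the total relation.\<close>

lemma restr_blocks: "restr (blocks \<pi>) = \<pi>"
proof -
  obtain n where P: "partition_on {1..n} (blocks \<pi>)" by (rule blocks_partition)
  have U: "\<Union>(blocks \<pi>) = {1..n}" using P by (simp add: partition_on_def)
  have rank: "rank_in {1..n} x = x" if "x \<in> {1..n}" for x
  proof -
    have "{y \<in> {1..n}. y \<le> x} = {1..x}" using that by auto
    then show ?thesis by (simp add: rank_in_def)
  qed
  have "rank_in {1..n} ` b = b" if "b \<in> blocks \<pi>" for b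
  proof -
    have "b \<subseteq> {1..n}" using U that by blast
    then have "rank_in {1..n} ` b = (\<lambda>x. x) ` b" by (intro image_cong refl rank) blast
    then show ?thesis by simp
  qed
  then have "standardize (blocks \<pi>) = blocks \<pi>" by (simp add: standardize_def U)
  then show ?thesis by (simp add: restr_def blocks_inverse)
qed

lemma
  shows total_relation_in_Ec: "blocks \<pi> \<times> blocks \<pi> \<in> Ec \<pi>"
    and total_relation_classes: "blocks \<pi> // (blocks \<pi> \<times> blocks \<pi>) = {blocks \<pi>}"
    and total_relation_quot: "card (blocks (ncp_quot \<pi> (blocks \<pi> \<times> blocks \<pi>))) = 1"
proof -
  obtain n where n: "n \<ge> 1" "partition_on {1..n} (blocks \<pi>)" by (rule blocks_partition)
  then have ne: "blocks \<pi> \<noteq> {}" by (auto simp: partition_on_def)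
  then show cl: "blocks \<pi> // (blocks \<pi> \<times> blocks \<pi>) = {blocks \<pi>}"
    by (auto simp: quotient_def)
  then have m: "merge_blocks \<pi> (blocks \<pi> \<times> blocks \<pi>) = {\<Union>(blocks \<pi>)}"
    by (simp add: merge_blocks_def)
  have "equiv (blocks \<pi>) (blocks \<pi> \<times> blocks \<pi>)"
    by (rule equivI) (auto simp: refl_on_def sym_def trans_def)
  then show Ec: "blocks \<pi> \<times> blocks \<pi> \<in> Ec \<pi>"
    by (simp add: Ec_def m noncrossing_def)
  show "card (blocks (ncp_quot \<pi> (blocks \<pi> \<times> blocks \<pi>))) = 1"
    by (simp add: blocks_ncp_quot[OF Ec] m)
qed

lemma class_proper_subset:
  assumes r: "equiv A r" and C: "C \<in> A // r" and ne: "r \<noteq> A \<times> A"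
  shows "C \<subset> A"
proof -
  have "C \<noteq> A"
  proof
    assume "C = A"
    then have "(x, y) \<in> r" if "x \<in> A" "y \<in> A" for x y
      using quotient_eq_iff[OF r C C] that by blast
    then show False using ne equiv_type[OF r] by blast
  qed
  with class_subset[OF r C] show ?thesis by blast
qed

text \<open>The equality of the convolutions at \<open>\<pi>\<close> can be solved for the value at \<open>\<pi>\<close>: only the total
  relation has a class with as many blocks as \<open>\<pi>\<close>.\<close>

lemma right_inverse_unique:
  fixes \<phi> \<psi> \<psi>' :: "'k::field_char_0 ncp_alg \<Rightarrow> 'k"
  assumes \<phi>: "\<phi> \<in> characters" and one: "\<And>\<pi>. card (blocks \<pi>) = 1 \<Longrightarrow> \<phi> (gen \<pi>) \<noteq> 0"
    and \<psi>: "\<psi> \<in> characters" and \<psi>': "\<psi>' \<in> characters"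
    and eq: "tens_form \<phi> \<psi> \<circ> delta = tens_form \<phi> \<psi>' \<circ> delta"
  shows "\<psi> = \<psi>'"
proof (rule characters_eqI[OF \<psi> \<psi>'])
  fix \<pi>
  show "\<psi> (gen \<pi>) = \<psi>' (gen \<pi>)"
  proof (induction "card (blocks \<pi>)" arbitrary: \<pi> rule: less_induct)
    case less
    let ?t = "\<lambda>\<psi> r. \<phi> (gen (ncp_quot \<pi> r)) * (\<Prod>C\<in>blocks \<pi> // r. \<psi> (gen (restr C)))"
    let ?R = "blocks \<pi> \<times> blocks \<pi>"
    have "sum (?t \<psi>) (Ec \<pi>) = sum (?t \<psi>') (Ec \<pi>)"
      using fun_cong[OF eq, of "gen \<pi>"] by (simp add: convolution_gen \<phi> \<psi> \<psi>')
    moreover have "?t \<psi> r = ?t \<psi>' r" if r: "r \<in> Ec \<pi> - {?R}" for r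
    proof -
      have eq: "equiv (blocks \<pi>) r" using r by (simp add: Ec_def)
      have "\<psi> (gen (restr C)) = \<psi>' (gen (restr C))" if C: "C \<in> blocks \<pi> // r" for C
      proof (rule less)
        have "C \<subset> blocks \<pi>" using class_proper_subset[OF eq C] r by blast
        moreover from this have "card (blocks (restr C)) = card C"
          using class_subset[OF eq C] by (intro card_blocks_restr) auto
        ultimately show "card (blocks (restr C)) < card (blocks \<pi>)"
          by (simp add: psubset_card_mono finite_blocks)
      qed
      then show ?thesis by simp
    qed
    then have "sum (?t \<psi>) (Ec \<pi> - {?R}) = sum (?t \<psi>') (Ec \<pi> - {?R})" by (rule sum.cong[OF refl])
    ultimately have "?t \<psi> ?R = ?t \<psi>' ?R"
      using sum.remove[OF finite_Ec total_relation_in_Ec, of "?t \<psi>" \<pi>]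
        sum.remove[OF finite_Ec total_relation_in_Ec, of "?t \<psi>'" \<pi>] by simp
    then show ?case
      using one[OF total_relation_quot] by (simp add: total_relation_classes restr_blocks)
  qed
qed

lemma lambda_s_eq: "lambda_s = alg_ext (\<lambda>c. c) flat_indicator"
  by (simp add: lambda_s_def blocks_eq_Base_iff_flat flat_indicator_def[abs_def])

lemma mu_s_eq: "mu_s = (alg_ext (\<lambda>c. c) flat_sign :: 'k::field_char_0 ncp_alg \<Rightarrow> 'k)"
proof -
  let ?l = "lambda_s :: 'k ncp_alg \<Rightarrow> 'k" and ?m = "alg_ext (\<lambda>c. c) flat_sign :: 'k ncp_alg \<Rightarrow> 'k"
  have char: "?l \<in> characters" "?m \<in> characters" "(eps_delta :: 'k ncp_alg \<Rightarrow> 'k) \<in> characters"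
    by (simp_all add: lambda_s_eq eps_delta_def alg_ext_character)
  have gen: "?l (gen \<pi>) = flat_indicator \<pi>" "?m (gen \<pi>) = flat_sign \<pi>"
    "(eps_delta (gen \<pi>) :: 'k) = (if card (blocks \<pi>) = 1 then 1 else 0)" for \<pi>
    unfolding lambda_s_eq eps_delta_def by (rule alg_ext_gen, simp)+
  have right: "tens_form ?l ?m \<circ> delta = eps_delta"
    by (rule characters_eqI[OF convolution_character[OF char(1,2)] char(3)])
      (simp add: convolution_gen[OF char(1,2)] gen indicator_sign_convolution)
  have left: "tens_form ?m ?l \<circ> delta = eps_delta"
    by (rule characters_eqI[OF convolution_character[OF char(2,1)] char(3)])
      (simp add: convolution_gen[OF char(2,1)] gen sign_indicator_convolution)
  have nz: "?l (gen \<pi>) \<noteq> 0" if "card (blocks \<pi>) = 1" for \<pi>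
    using flat_if_card_one[OF that] by (simp add: gen flat_indicator_def)
  have "y = ?m" if "y \<in> characters" "tens_form ?l y \<circ> delta = eps_delta" for y
    by (rule right_inverse_unique[OF char(1) nz that(1) char(2)]) (simp_all add: that right)
  note unique = this
  show ?thesis
    unfolding mu_s_def m_inv_def char_monoid_def monoid.simps partial_object.simps
  proof (rule the_equality)
    show "?m \<in> characters \<and> tens_form ?l ?m \<circ> delta = eps_delta \<and> tens_form ?m ?l \<circ> delta = eps_delta"
      using char(2) right left by (intro conjI)
    show "y = ?m" if "y \<in> characters \<and> tens_form ?l y \<circ> delta = eps_delta \<and> tens_form y ?l \<circ> delta = eps_delta" for y
      using that unique by (elim conjE)
  qed
qed

theorem proposition4p15:
  fixes \<pi> :: ncp
  shows "mu_s (gen \<pi> :: 'k::field_char_0 ncp_alg) =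
    (if blocks \<pi> \<noteq> Base \<pi> then 0 else (- 1) ^ (card (blocks \<pi>) - 1))"
proof -
  have "mu_s (gen \<pi> :: 'k ncp_alg) = flat_sign \<pi>"
    unfolding mu_s_eq by (rule alg_ext_gen) simp
  then show ?thesis
    by (simp add: flat_sign_def blocks_eq_Base_iff_flat)
qed

end
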